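(* Let $G$ be a finite simple connected graph with at least three vertices. Every edge-locating coloring of $G$ is an edge distinguishing coloring of $G$.
   Context: For a proper edge coloring $c:E(G)\to\{1,\dots,k\}$ of $G$, let $\pi=(\mathcal{C}_1,\dots,\mathcal{C}_k)$ be the ordered partition of $E(G)$ into color classes. For a vertex $v$ and an edge $e=xy$, $d(v,e)=\min\{d(v,x),d(v,y)\}$, and $d(v,\mathcal{C}_i)=\min\{d(v,e): e\in\mathcal{C}_i\}$. The edge color code of $v$ is $c_\pi(v)=(d(v,\mathcal{C}_1),\dots,d(v,\mathcal{C}_k))$. The coloring $c$ is an edge-locating coloring if distinct vertices have distinct edge color codes. An automorphism $f$ of $G$ acts on edges by $f(xy)=f(x)f(y)$; $f$ preserves $c$ if $c(f(e))=c(e)$ for every edge $e$. An edge distinguishing coloring is a proper edge coloring such that the only automorphism of $G$ preserving it is the identity. *)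

theory Defs
  imports Main "HOL-Library.Extended_Nat"
begin

definition simple_graph :: "'a set \<Rightarrow> 'a set set \<Rightarrow> bool" where
  "simple_graph V E \<longleftrightarrow> (\<forall>e\<in>E. e \<subseteq> V \<and> card e = 2)"

definition is_walk :: "'a set \<Rightarrow> 'a set set \<Rightarrow> 'a list \<Rightarrow> bool" where
  "is_walk V E p \<longleftrightarrow> p \<noteq> [] \<and> set p \<subseteq> V \<and> successively (\<lambda>x y. {x, y} \<in> E) p"

definition walks_between :: "'a set \<Rightarrow> 'a set set \<Rightarrow> 'a \<Rightarrow> 'a \<Rightarrow> 'a list set" where
  "walks_between V E u v = {p. is_walk V E p \<and> hd p = u \<and> last p = v}"

definition connected_graph :: "'a set \<Rightarrow> 'a set set \<Rightarrow> bool" where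
  "connected_graph V E \<longleftrightarrow> V \<noteq> {} \<and> (\<forall>u\<in>V. \<forall>v\<in>V. walks_between V E u v \<noteq> {})"

text \<open>Distances take values in \<^typ>\<open>enat\<close>, where every nonempty set attains its infimum and the
  infimum of the empty set is \<open>\<infinity>\<close>. A walk is a list of vertices, so it has one edge fewer than entries.\<close>

definition vertex_dist :: "'a set \<Rightarrow> 'a set set \<Rightarrow> 'a \<Rightarrow> 'a \<Rightarrow> enat" where
  "vertex_dist V E u v = (INF p\<in>walks_between V E u v. enat (length p - 1))"

definition edge_dist :: "'a set \<Rightarrow> 'a set set \<Rightarrow> 'a \<Rightarrow> 'a set \<Rightarrow> enat" where
  "edge_dist V E v e = (INF x\<in>e. vertex_dist V E v x)"

definition edge_set_dist :: "'a set \<Rightarrow> 'a set set \<Rightarrow> 'a \<Rightarrow> 'a set set \<Rightarrow> enat" where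
  "edge_set_dist V E v C = (INF e\<in>C. edge_dist V E v e)"

text \<open>Not all \<open>k\<close> colors need occur. A class that is empty contributes the same entry \<open>\<infinity>\<close>
  to the code of every vertex, so it distinguishes no two vertices.\<close>

definition proper_edge_coloring :: "'a set set \<Rightarrow> nat \<Rightarrow> ('a set \<Rightarrow> nat) \<Rightarrow> bool" where
  "proper_edge_coloring E k c \<longleftrightarrow>
     c ` E \<subseteq> {1..k} \<and>
     (\<forall>e\<in>E. \<forall>e'\<in>E. e \<noteq> e' \<and> e \<inter> e' \<noteq> {} \<longrightarrow> c e \<noteq> c e')"

definition color_class :: "'a set set \<Rightarrow> ('a set \<Rightarrow> nat) \<Rightarrow> nat \<Rightarrow> 'a set set" where
  "color_class E c i = {e \<in> E. c e = i}"

definition edge_color_code ::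
    "'a set \<Rightarrow> 'a set set \<Rightarrow> nat \<Rightarrow> ('a set \<Rightarrow> nat) \<Rightarrow> 'a \<Rightarrow> enat list" where
  "edge_color_code V E k c v = map (\<lambda>i. edge_set_dist V E v (color_class E c i)) [1..<Suc k]"

definition edge_locating_coloring ::
    "'a set \<Rightarrow> 'a set set \<Rightarrow> nat \<Rightarrow> ('a set \<Rightarrow> nat) \<Rightarrow> bool" where
  "edge_locating_coloring V E k c \<longleftrightarrow>
     proper_edge_coloring E k c \<and>
     (\<forall>u\<in>V. \<forall>v\<in>V. u \<noteq> v \<longrightarrow> edge_color_code V E k c u \<noteq> edge_color_code V E k c v)"

definition graph_automorphism :: "'a set \<Rightarrow> 'a set set \<Rightarrow> ('a \<Rightarrow> 'a) \<Rightarrow> bool" where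
  "graph_automorphism V E f \<longleftrightarrow>
     bij_betw f V V \<and> (\<forall>u\<in>V. \<forall>v\<in>V. {u, v} \<in> E \<longleftrightarrow> {f u, f v} \<in> E)"

definition preserves_coloring :: "'a set set \<Rightarrow> ('a set \<Rightarrow> nat) \<Rightarrow> ('a \<Rightarrow> 'a) \<Rightarrow> bool" where
  "preserves_coloring E c f \<longleftrightarrow> (\<forall>e\<in>E. c (f ` e) = c e)"

text \<open>Automorphisms are functions on the whole type of which only the values on \<open>V\<close> matter,
  so being the identity is required on \<open>V\<close> only.\<close>

definition edge_distinguishing_coloring ::
    "'a set \<Rightarrow> 'a set set \<Rightarrow> nat \<Rightarrow> ('a set \<Rightarrow> nat) \<Rightarrow> bool" where
  "edge_distinguishing_coloring V E k c \<longleftrightarrow>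
     proper_edge_coloring E k c \<and>
     (\<forall>f. graph_automorphism V E f \<and> preserves_coloring E c f \<longrightarrow> (\<forall>v\<in>V. f v = v))"

end

theory Submission
  imports Defs
begin

text \<open>An automorphism \<open>f\<close> preserves distances, and if it preserves the coloring it permutes the edges
  within each color class. Hence \<open>v\<close> and \<open>f v\<close> have the same distance to every color class, that is,
  the same code, and an edge-locating coloring then forces \<open>f v = v\<close>.\<close>

lemma walks_between_map:
  assumes "\<And>x. x \<in> V \<Longrightarrow> f x \<in> V"
    and "\<And>x y. x \<in> V \<Longrightarrow> y \<in> V \<Longrightarrow> {x, y} \<in> E \<Longrightarrow> {f x, f y} \<in> E"
    and "p \<in> walks_between V E u v"
  shows "map f p \<in> walks_between V E (f u) (f v)"
proof -
  have p: "p \<noteq> []" "set p \<subseteq> V" "successively (\<lambda>x y. {x, y} \<in> E) p" "hd p = u" "last p = v"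
    using assms(3) by (auto simp: walks_between_def is_walk_def)
  have "successively (\<lambda>x y. {f x, f y} \<in> E) p"
    \<comment> \<open>Consecutive entries of \<open>p\<close> lie in \<open>V\<close>, the only
      place where \<open>f\<close> is known to preserve edges.\<close>
    by (rule successively_mono[OF p(3)]) (use p(2) assms(2) in blast)
  then have "successively (\<lambda>x y. {x, y} \<in> E) (map f p)"
    by (simp add: successively_map)
  then show ?thesis
    using p assms(1) by (auto simp: walks_between_def is_walk_def hd_map last_map)
qed

text \<open>Mapping \<open>f\<close> over a walk keeps its length, so each walk from
  \<open>u\<close> to \<open>v\<close> is matched by an equally long one between the images. If an
  endpoint lies outside \<open>V\<close>, there are no walks and the right side is
  \<open>\<infinity>\<close>.\<close>

lemma vertex_dist_hom_le:
  assumes "\<And>x. x \<in> V \<Longrightarrow> f x \<in> V"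
    and "\<And>x y. x \<in> V \<Longrightarrow> y \<in> V \<Longrightarrow> {x, y} \<in> E \<Longrightarrow> {f x, f y} \<in> E"
  shows "vertex_dist V E (f u) (f v) \<le> vertex_dist V E u v"
  unfolding vertex_dist_def
proof (rule INF_mono)
  fix p assume "p \<in> walks_between V E u v"
  then have "map f p \<in> walks_between V E (f u) (f v)"
    by (rule walks_between_map[rotated 2]) (fact assms)+
  then show "\<exists>q\<in>walks_between V E (f u) (f v). enat (length q - 1) \<le> enat (length p - 1)"
    by (rule bexI[rotated]) simp
qed

text \<open>The edge condition is an equivalence, so reading it at the preimages of \<open>x\<close>
  and \<open>y\<close> gives the condition for the inverse. This turns the one-sided distance bound
  into an equality.\<close>

lemma graph_automorphism_inv_into:
  assumes "graph_automorphism V E f"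
  shows "graph_automorphism V E (inv_into V f)"
proof -
  have bij: "bij_betw f V V" and edge: "\<And>x y. x \<in> V \<Longrightarrow> y \<in> V \<Longrightarrow> {x, y} \<in> E \<longleftrightarrow> {f x, f y} \<in> E"
    using assms unfolding graph_automorphism_def by blast+
  have inv: "bij_betw (inv_into V f) V V"
    by (rule bij_betw_inv_into[OF bij])
  have "{x, y} \<in> E \<longleftrightarrow> {inv_into V f x, inv_into V f y} \<in> E" if "x \<in> V" "y \<in> V" for x y
    using edge[OF bij_betw_apply[OF inv that(1)] bij_betw_apply[OF inv that(2)]]
    by (simp only: bij_betw_inv_into_right[OF bij] that)
  then show ?thesis
    using inv by (simp only: graph_automorphism_def) blast
qed

lemma vertex_dist_automorphism_le:
  assumes "graph_automorphism V E f"
  shows "vertex_dist V E (f u) (f v) \<le> vertex_dist V E u v"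
proof (rule vertex_dist_hom_le)
  show "f x \<in> V" if "x \<in> V" for x
    using assms that unfolding graph_automorphism_def by (blast intro: bij_betw_apply)
  show "{f x, f y} \<in> E" if "x \<in> V" "y \<in> V" "{x, y} \<in> E" for x y
    using assms that unfolding graph_automorphism_def by blast
qed

lemma vertex_dist_automorphism:
  assumes "graph_automorphism V E f" and "u \<in> V" and "v \<in> V"
  shows "vertex_dist V E (f u) (f v) = vertex_dist V E u v"
proof (rule antisym)
  have "bij_betw f V V"
    using assms(1) by (simp add: graph_automorphism_def)
  \<comment> \<open>The bound for the inverse is applied at \<open>f u\<close> and
    \<open>f v\<close>; the inverse cancels \<open>f\<close> there because \<open>u\<close> and
    \<open>v\<close> lie in \<open>V\<close>.\<close>
  then show "vertex_dist V E u v \<le> vertex_dist V E (f u) (f v)"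
    using vertex_dist_automorphism_le[OF graph_automorphism_inv_into[OF assms(1)], of "f u" "f v"]
      assms(2,3) by (simp add: bij_betw_inv_into_left)
qed (rule vertex_dist_automorphism_le[OF assms(1)])

lemma edge_dist_automorphism:
  assumes "graph_automorphism V E f" and "v \<in> V" and "e \<subseteq> V"
  shows "edge_dist V E (f v) (f ` e) = edge_dist V E v e"
  unfolding edge_dist_def image_image
  by (rule INF_cong[OF refl]) (simp add: vertex_dist_automorphism[OF assms(1,2)] subsetD[OF assms(3)])

text \<open>Not only do edges map to edges of the same color, but every edge is also the image of an
  edge, which must then share its color. This gives both inclusions.\<close>

lemma image_color_class_automorphism:
  assumes "simple_graph V E" and "graph_automorphism V E f" and "preserves_coloring E c f"
  shows "(`) f ` color_class E c i = color_class E c i"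
proof -
  have surj: "f ` V = V" and edge: "\<And>x y. x \<in> V \<Longrightarrow> y \<in> V \<Longrightarrow> {x, y} \<in> E \<longleftrightarrow> {f x, f y} \<in> E"
    using assms(2) unfolding graph_automorphism_def bij_betw_def by blast+
  have ends: "\<exists>x y. e = {x, y} \<and> x \<in> V \<and> y \<in> V" if "e \<in> E" for e
    using assms(1) that by (fastforce simp: simple_graph_def card_2_iff)
  have color: "c (f ` e) = c e" if "e \<in> E" for e
    using assms(3) that by (simp add: preserves_coloring_def)
  have "f ` e \<in> E" if in_E: "e \<in> E" for e
  proof -
    obtain x y where e: "e = {x, y}" "x \<in> V" "y \<in> V"
      using ends[OF in_E] by blast
    then show ?thesis
      using in_E edge[OF e(2,3)] by simp
  qed
  \<comment> \<open>Pull both ends of \<open>e\<close> back along the surjection \<open>f\<close>;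
    the backward direction of the edge equivalence makes the preimages adjacent.\<close>
  moreover have "\<exists>d\<in>E. e = f ` d" if in_E: "e \<in> E" for e
  proof -
    obtain x y where e: "e = {x, y}" "x \<in> V" "y \<in> V"
      using ends[OF in_E] by blast
    then obtain x' y' where xy: "x = f x'" "y = f y'" "x' \<in> V" "y' \<in> V"
      using surj by blast
    then have "{x', y'} \<in> E" "e = f ` {x', y'}"
      using e in_E edge[of x' y'] by simp_all
    then show ?thesis
      by blast
  qed
  ultimately show ?thesis
    using color unfolding color_class_def by (auto simp: image_iff) metis
qed

lemma edge_color_code_automorphism:
  assumes "simple_graph V E" and "graph_automorphism V E f" and "preserves_coloring E c f"
    and "v \<in> V"
  shows "edge_color_code V E k c (f v) = edge_color_code V E k c v"
proof -
  have "edge_set_dist V E (f v) (color_class E c i) = edge_set_dist V E v (color_class E c i)" for i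
  proof -
    \<comment> \<open>Writing the class as its own image under \<open>f\<close> reindexes the
      infimum, so that \<open>f\<close> acts on vertex and edge alike and can be cancelled
      termwise.\<close>
    have "edge_set_dist V E (f v) (color_class E c i)
        = (INF e\<in>color_class E c i. edge_dist V E (f v) (f ` e))"
      unfolding edge_set_dist_def
      by (subst image_color_class_automorphism[OF assms(1-3), symmetric]) (simp add: image_image)
    also have "\<dots> = edge_set_dist V E v (color_class E c i)"
      unfolding edge_set_dist_def
    proof (rule INF_cong)
      fix e assume "e \<in> color_class E c i"
      then have "e \<subseteq> V"
        using assms(1) by (simp add: color_class_def simple_graph_def)
      then show "edge_dist V E (f v) (f ` e) = edge_dist V E v e"
        by (rule edge_dist_automorphism[OF assms(2,4)])
    qed simp
    finally show ?thesis .
  qed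
  then show ?thesis
    by (simp add: edge_color_code_def)
qed

theorem theorem24:
  fixes V :: "'a set" and E :: "'a set set" and k :: nat and c :: "'a set \<Rightarrow> nat"
  assumes "simple_graph V E"
    and "finite V"
    and "connected_graph V E"
    and "card V \<ge> 3"
    and "edge_locating_coloring V E k c"
  shows "edge_distinguishing_coloring V E k c"
  unfolding edge_distinguishing_coloring_def
proof (intro conjI allI impI ballI)
  show "proper_edge_coloring E k c"
    using assms(5) by (simp add: edge_locating_coloring_def)
next
  fix f v
  assume f: "graph_automorphism V E f \<and> preserves_coloring E c f" and v: "v \<in> V"
  \<comment> \<open>The locating property compares codes of vertices in \<open>V\<close> only, so
    \<open>f v\<close> has to be placed there first.\<close>
  then have "f v \<in> V"
    unfolding graph_automorphism_def by (blast intro: bij_betw_apply)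
  moreover have "edge_color_code V E k c (f v) = edge_color_code V E k c v"
    using edge_color_code_automorphism[OF assms(1)] f v by blast
  ultimately show "f v = v"
    using assms(5) v unfolding edge_locating_coloring_def by blast
qed

end
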